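(* Let $D,\Omega\subset\mathbb{C}^d$ be bounded domains that are complete with respect to their Kobayashi distances. Suppose $D$ is metrically-regular and $\Omega$ satisfies: (a) for every $x\in\partial\Omega$ and every $R>0$, $H^s_p(x,R)$ is nonempty for some (equivalently, any) pole $p\in\Omega$; (b) for any two distinct points $x,y\in\partial\Omega$ there is $R>0$ with $H^b_p(x,R)\neq H^b_p(y,R)$. Then every biholomorphism $\Psi:D\to\Omega$ extends to a homeomorphism from $\overline{D}$ onto $\overline{\Omega}$.
   Context: For a Kobayashi hyperbolic domain $\Omega\subset\mathbb{C}^d$ with Kobayashi distance $\mathsf{k}_\Omega$, $x\in\partial\Omega$, $p\in\Omega$, $R>0$: $H^s_p(x,R)=\{z\in\Omega:\limsup_{w\to x}(\mathsf{k}_\Omega(z,w)-\mathsf{k}_\Omega(p,w))<\tfrac12\log R\}$ and $H^b_p(x,R)=\{z\in\Omega:\liminf_{w\to x}(\mathsf{k}_\Omega(z,w)-\mathsf{k}_\Omega(p,w))<\tfrac12\log R\}$. If for a complete Kobayashi hyperbolic domain $D$, a point $\xi\in\partial D$ and $o\in D$ the limit $\lim_{w\to\xi}(\mathsf{k}_D(z,w)-\mathsf{k}_D(o,w))$ exists for all $z\in D$, the horosphere is $H(\xi,R)=H_o(\xi,R)=\{z\in D:\lim_{w\to\xi}(\mathsf{k}_D(z,w)-\mathsf{k}_D(o,w))<\tfrac12\log R\}$. A complete Kobayashi hyperbolic domain $D$ is metrically-regular if there is $o\in D$ such that (1) for every $\xi\in\partial D$ and $z\in D$ the limit $\lim_{w\to\xi}(\mathsf{k}_D(z,w)-\mathsf{k}_D(o,w))$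 exists, and (2) for any distinct $\xi_1,\xi_2\in\partial D$ there is $R>0$ with $H_o(\xi_1,R)\cap H_o(\xi_2,R)=\emptyset$. *)

theory Defs
  imports "HOL-Analysis.Analysis"
begin

text \<open>Holomorphic map between open subsets of complex vector spaces: complex Frechet differentiable,
  i.e. real differentiable with complex-linear derivative.\<close>
definition holo_on :: "(complex ^ 'n \<Rightarrow> complex ^ 'm) \<Rightarrow> (complex ^ 'n) set \<Rightarrow> bool" where
  "holo_on f S \<longleftrightarrow> (\<forall>z\<in>S. \<exists>f'. (f has_derivative f') (at z) \<and>
       (\<forall>c v. f' (c *s v) = c *s f' v))"

definition biholomorphism ::
  "(complex ^ 'n \<Rightarrow> complex ^ 'n) \<Rightarrow> (complex ^ 'n) set \<Rightarrow> (complex ^ 'n) set \<Rightarrow> bool" where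
  "biholomorphism f D \<Omega> \<longleftrightarrow> bij_betw f D \<Omega> \<and> holo_on f D \<and>
     (\<exists>g. holo_on g \<Omega> \<and> g ` \<Omega> \<subseteq> D \<and> (\<forall>z\<in>D. g (f z) = z) \<and> (\<forall>w\<in>\<Omega>. f (g w) = w))"

definition domain :: "(complex ^ 'n) set \<Rightarrow> bool" where
  "domain S \<longleftrightarrow> open S \<and> connected S \<and> S \<noteq> {}"

definition holo_disc :: "(complex \<Rightarrow> complex ^ 'n) \<Rightarrow> (complex ^ 'n) set \<Rightarrow> bool" where
  "holo_disc \<phi> \<Omega> \<longleftrightarrow> (\<forall>i. (\<lambda>\<zeta>. \<phi> \<zeta> $ i) holomorphic_on ball 0 1) \<and> \<phi> ` ball 0 1 \<subseteq> \<Omega>"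

text \<open>Lempert function, using the Poincare distance rho(0,t) = artanh |t| on the unit disc.\<close>
definition lempert :: "(complex ^ 'n) set \<Rightarrow> complex ^ 'n \<Rightarrow> complex ^ 'n \<Rightarrow> real" where
  "lempert \<Omega> z w = Inf {artanh (cmod t) | t \<phi>. t \<in> ball 0 1 \<and> holo_disc \<phi> \<Omega> \<and> \<phi> 0 = z \<and> \<phi> t = w}"

definition kob :: "(complex ^ 'n) set \<Rightarrow> complex ^ 'n \<Rightarrow> complex ^ 'n \<Rightarrow> real" where
  "kob \<Omega> z w = Inf {(\<Sum>i<length xs - 1. lempert \<Omega> (xs ! i) (xs ! Suc i)) | xs.
      xs \<noteq> [] \<and> hd xs = z \<and> last xs = w \<and> set xs \<subseteq> \<Omega>}"

definition kob_complete :: "(complex ^ 'n) set \<Rightarrow> bool" where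
  "kob_complete \<Omega> \<longleftrightarrow> (\<forall>x :: nat \<Rightarrow> complex ^ 'n. (\<forall>n. x n \<in> \<Omega>) \<longrightarrow>
      (\<forall>e>0. \<exists>N. \<forall>m\<ge>N. \<forall>n\<ge>N. kob \<Omega> (x m) (x n) < e) \<longrightarrow>
      (\<exists>y\<in>\<Omega>. (\<lambda>n. kob \<Omega> (x n) y) \<longlonglongrightarrow> 0))"

definition horo_s :: "(complex ^ 'n) set \<Rightarrow> complex ^ 'n \<Rightarrow> complex ^ 'n \<Rightarrow> real \<Rightarrow> (complex ^ 'n) set" where
  "horo_s \<Omega> p x R = {z \<in> \<Omega>. Limsup (at x within \<Omega>) (\<lambda>w. ereal (kob \<Omega> z w - kob \<Omega> p w)) < ereal (ln R / 2)}"

definition horo_b :: "(complex ^ 'n) set \<Rightarrow> complex ^ 'n \<Rightarrow> complex ^ 'n \<Rightarrow> real \<Rightarrow> (complex ^ 'n) set" where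
  "horo_b \<Omega> p x R = {z \<in> \<Omega>. Liminf (at x within \<Omega>) (\<lambda>w. ereal (kob \<Omega> z w - kob \<Omega> p w)) < ereal (ln R / 2)}"

text \<open>Horosphere H_o(xi,R), used when the limit exists.\<close>
definition horo :: "(complex ^ 'n) set \<Rightarrow> complex ^ 'n \<Rightarrow> complex ^ 'n \<Rightarrow> real \<Rightarrow> (complex ^ 'n) set" where
  "horo D o' \<xi> R = {z \<in> D. Lim (at \<xi> within D) (\<lambda>w. kob D z w - kob D o' w) < ln R / 2}"

definition metrically_regular :: "(complex ^ 'n) set \<Rightarrow> bool" where
  "metrically_regular D \<longleftrightarrow> kob_complete D \<and>
     (\<exists>o'\<in>D. (\<forall>\<xi>\<in>frontier D. \<forall>z\<in>D. \<exists>L. ((\<lambda>w. kob D z w - kob D o' w) \<longlongrightarrow> L) (at \<xi> within D)) \<and>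
        (\<forall>\<xi>1\<in>frontier D. \<forall>\<xi>2\<in>frontier D. \<xi>1 \<noteq> \<xi>2 \<longrightarrow>
            (\<exists>R>0. horo D o' \<xi>1 R \<inter> horo D o' \<xi>2 R = {})))"

end

theory Submission
  imports Defs
begin

text \<open>
  The only property of the Kobayashi distance that is needed is its invariance under \<open>\<Psi>\<close>; write
  \<open>g\<close> for the inverse of \<open>\<Psi>\<close> and \<open>h\<^sub>\<xi>(z)\<close> for the limit of \<open>k\<^sub>D(z,w) - k\<^sub>D(o,w)\<close> as \<open>w \<rightarrow> \<xi>\<close>.
  If \<open>\<xi>\<close> is a cluster point of \<open>g\<close> at \<open>x \<in> \<partial>\<Omega>\<close>, then \<open>k\<^sub>\<Omega>(z,w) - k\<^sub>\<Omega>(p,w)\<close> clusters at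
  \<open>h\<^sub>\<xi>(g z) - h\<^sub>\<xi>(g p)\<close>. A point of a small horosphere \<open>H\<^sup>s\<^sub>p(x,R)\<close> is thus mapped by \<open>g\<close> into small
  horospheres at every cluster point, so by metric regularity there is only one cluster point, and
  \<open>g\<close> extends continuously to \<open>\<partial>\<Omega>\<close>. Consequently \<open>k\<^sub>\<Omega>(z,w) - k\<^sub>\<Omega>(p,w)\<close> has a limit at \<open>x\<close> that
  depends only on the extended value \<open>g x\<close>. Hence two boundary points with the same image have the
  same big horospheres, and condition (b) makes the extension injective.
\<close>

section \<open>Cluster points and extension to the closure\<close>

text \<open>Filter form of passing to a convergent subsequence, which \<open>F'\<close> stands for:
  refining \<open>F\<close> by the preimages of neighbourhoods of a cluster point leaves it
  nontrivial.\<close>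

lemma compact_cluster_filter:
  assumes "compact K" "F \<noteq> bot" "eventually (\<lambda>w. f w \<in> K) F"
  obtains \<xi> F' where "\<xi> \<in> K" "F' \<le> F" "F' \<noteq> bot" "(f \<longlongrightarrow> \<xi>) F'"
proof -
  obtain \<xi> where \<xi>: "\<xi> \<in> K" "inf (nhds \<xi>) (filtermap f F) \<noteq> bot"
    using assms(1)[unfolded compact_filter, rule_format, of "filtermap f F"] assms(2,3)
    by (auto simp: filtermap_bot_iff eventually_filtermap)
  define F' where "F' = inf F (filtercomap f (nhds \<xi>))"
  have "F' \<noteq> bot"
  proof
    assume "F' = bot"
    then obtain P Q where P: "eventually P F" and Q: "eventually Q (nhds \<xi>)"
      and PQ: "\<And>w. P w \<Longrightarrow> \<not> Q (f w)"
      unfolding F'_def trivial_limit_def eventually_inf eventually_filtercomap by blast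
    have "eventually (\<lambda>y. \<not> Q y) (filtermap f F)"
      using P PQ by (auto simp: eventually_filtermap elim: eventually_mono)
    then have "eventually (\<lambda>y. False) (inf (nhds \<xi>) (filtermap f F))"
      using Q unfolding eventually_inf by blast
    then show False
      using \<xi>(2) by (simp add: trivial_limit_def)
  qed
  moreover have "(f \<longlongrightarrow> \<xi>) F'"
    unfolding F'_def filterlim_iff_le_filtercomap by simp
  ultimately show thesis
    using that[of \<xi> F'] \<xi>(1) by (simp add: F'_def)
qed

text \<open>Otherwise \<open>F\<close> restricted to where \<open>f\<close> avoids some
  neighbourhood of \<open>\<xi>\<close> is nontrivial. Compactness gives it a cluster point, which
  must be \<open>\<xi>\<close> and so lies in the avoided neighbourhood.\<close>

lemma tendsto_if_unique_cluster_point: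
  assumes K: "compact K" "eventually (\<lambda>w. f w \<in> K) F"
    and uniq: "\<And>\<eta> F'. F' \<le> F \<Longrightarrow> F' \<noteq> bot \<Longrightarrow> (f \<longlongrightarrow> \<eta>) F' \<Longrightarrow> \<eta> = \<xi>"
  shows "(f \<longlongrightarrow> \<xi>) F"
proof (rule topological_tendstoI, rule ccontr)
  fix U assume U: "open U" "\<xi> \<in> U" and nev: "\<not> eventually (\<lambda>w. f w \<in> U) F"
  define F2 where "F2 = inf F (principal {w. f w \<notin> U})"
  have "F2 \<noteq> bot"
    using nev by (simp add: F2_def trivial_limit_def eventually_inf_principal)
  moreover have "F2 \<le> F"
    by (simp add: F2_def)
  moreover from this have "eventually (\<lambda>w. f w \<in> K) F2"
    using K(2) by (rule filter_leD)
  ultimately obtain \<eta> F' where \<eta>: "F' \<le> F2" "F' \<noteq> bot" "(f \<longlongrightarrow> \<eta>) F'"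
    using compact_cluster_filter[OF K(1)] by metis
  have "\<eta> = \<xi>"
    using uniq[of F' \<eta>] \<eta> \<open>F2 \<le> F\<close> by auto
  then have "eventually (\<lambda>w. f w \<in> U) F'"
    using \<eta>(3) U topological_tendstoD by blast
  moreover have "eventually (\<lambda>w. f w \<notin> U) F'"
    by (rule filter_leD[OF \<eta>(1)]) (simp add: F2_def eventually_inf_principal)
  ultimately have "eventually (\<lambda>w. False) F'"
    by eventually_elim simp
  then show False
    using \<eta>(2) by (simp add: trivial_limit_def)
qed

text \<open>The hypothesis controls approach through \<open>S\<close> only; at a nearby
  \<open>y\<close> outside \<open>S\<close>, the value \<open>f y\<close> is itself a limit of
  values on \<open>S\<close>.\<close>

lemma continuous_on_closure_if_tendsto:
  fixes f :: "'a::t1_space \<Rightarrow> 'b::metric_space"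
  assumes lim: "\<And>x. x \<in> closure S \<Longrightarrow> (f \<longlongrightarrow> f x) (at x within S)"
  shows "continuous_on (closure S) f"
  unfolding continuous_on_def
proof (intro ballI tendstoI)
  fix x and e :: real assume x: "x \<in> closure S" and e: "e > 0"
  obtain U where U: "open U" "x \<in> U"
    and near: "\<And>y. y \<in> U \<Longrightarrow> y \<noteq> x \<Longrightarrow> y \<in> S \<Longrightarrow> dist (f y) (f x) < e / 2"
    using tendstoD[OF lim[OF x], of "e / 2"] e unfolding eventually_at_topological by auto
  have "dist (f y) (f x) < e" if y: "y \<in> U" "y \<noteq> x" "y \<in> closure S" for y
  proof (cases "y \<in> S")
    case True
    with near[of y] y e show ?thesis by simp
  next
    case False
    have nt: "at y within S \<noteq> bot"
      using y(3) False by (simp add: closure_def at_within_eq_bot_iff islimpt_def trivial_limit_within)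
    \<comment> \<open>Points of \<open>S\<close> close to \<open>y\<close> lie in \<open>U\<close>
      and differ from \<open>x\<close>, so \<open>near\<close> applies. The limit may reach the edge
      of the closed ball, hence the margin \<open>e / 2\<close>.\<close>
    have "open (U - {x})" using U by (simp add: open_Diff)
    then have "eventually (\<lambda>w. f w \<in> cball (f x) (e / 2)) (at y within S)"
      unfolding eventually_at_topological
      by (rule_tac x = "U - {x}" in exI) (use y near in \<open>force simp: dist_commute\<close>)
    then have "f y \<in> cball (f x) (e / 2)"
      by (rule Lim_in_closed_set[OF closed_cball _ nt lim[OF y(3)]])
    then show ?thesis using e by (simp add: dist_commute)
  qed
  then show "eventually (\<lambda>y. dist (f y) (f x) < e) (at x within closure S)"
    unfolding eventually_at_topological using U by blast
qed

section \<open>Biholomorphic invariance of the Kobayashi distance\<close>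

lemma holo_on_imp_continuous_on: "holo_on f S \<Longrightarrow> continuous_on S f"
  unfolding holo_on_def
  by (meson continuous_at_imp_continuous_on has_derivative_continuous)

text \<open>Chain rule: complex linearity of \<open>f'\<close> turns the derivative
  \<open>\<lambda>h. h *s v\<close> of \<open>\<phi>\<close> into
  \<open>\<lambda>h. h *s f' v\<close>, whose coordinates are complex derivatives.\<close>

lemma holo_disc_compose:
  assumes f: "holo_on f S" "f ` S \<subseteq> T" and \<phi>: "holo_disc \<phi> S"
  shows "holo_disc (f \<circ> \<phi>) T"
  unfolding holo_disc_def
proof (intro conjI allI)
  show "(f \<circ> \<phi>) ` ball 0 1 \<subseteq> T"
    using assms unfolding holo_disc_def image_comp[symmetric] by blast
  fix i
  show "(\<lambda>\<zeta>. (f \<circ> \<phi>) \<zeta> $ i) holomorphic_on ball 0 1"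
    unfolding holomorphic_on_open[OF open_ball]
  proof
    fix \<zeta> :: complex assume \<zeta>: "\<zeta> \<in> ball 0 1"
    define v where "v = (\<chi> j. deriv (\<lambda>\<zeta>. \<phi> \<zeta> $ j) \<zeta>)"
    have "((\<lambda>\<zeta>. \<phi> \<zeta> $ j) has_field_derivative v $ j) (at \<zeta>)" for j
      using \<phi> \<zeta> unfolding holo_disc_def v_def
      by (simp add: holomorphic_derivI[of _ "ball 0 1"])
    then have comp: "((\<lambda>\<zeta>. \<phi> \<zeta> $ j) has_derivative (\<lambda>h. (h *s v) $ j)) (at \<zeta>)" for j
      by (simp add: has_field_derivative_def mult_commute_abs)
    have der: "(\<phi> has_derivative (\<lambda>h. h *s v)) (at \<zeta>)"
      unfolding has_derivative_componentwise_within[of \<phi>]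
    proof
      fix b :: "complex ^ 'a" assume "b \<in> Basis"
      then obtain j c where "b = axis j c" by (auto simp: Basis_vec_def)
      then show "((\<lambda>x. \<phi> x \<bullet> b) has_derivative (\<lambda>x. (x *s v) \<bullet> b)) (at \<zeta>)"
        using has_derivative_inner_left[OF comp[of j], of c] by (simp add: inner_axis)
    qed
    have "\<phi> \<zeta> \<in> S"
      using \<phi> \<zeta> unfolding holo_disc_def by blast
    then obtain f' where f': "(f has_derivative f') (at (\<phi> \<zeta>))" "\<And>c v. f' (c *s v) = c *s f' v"
      using f(1) unfolding holo_on_def by blast
    have "((\<lambda>\<zeta>. f (\<phi> \<zeta>)) has_derivative (\<lambda>h. h *s f' v)) (at \<zeta>)"
      using has_derivative_compose[OF der f'(1)] by (simp add: f'(2))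
    from bounded_linear.has_derivative[OF bounded_linear_vec_nth this]
    have "((\<lambda>\<zeta>. (f \<circ> \<phi>) \<zeta> $ i) has_field_derivative f' v $ i) (at \<zeta>)"
      by (simp add: has_field_derivative_def mult_commute_abs)
    then show "\<exists>d. ((\<lambda>\<zeta>. (f \<circ> \<phi>) \<zeta> $ i) has_field_derivative d) (at \<zeta>)" ..
  qed
qed

text \<open>Composing with \<open>f\<close> or \<open>g\<close> exchanges the discs of the two
  domains and keeps \<open>t\<close>, so both infima range over the same set.\<close>

lemma lempert_biholomorphic:
  assumes f: "holo_on f D" "f ` D \<subseteq> \<Omega>" and g: "holo_on g \<Omega>" "g ` \<Omega> \<subseteq> D"
    and gf: "\<And>z. z \<in> D \<Longrightarrow> g (f z) = z"
    and zw: "z \<in> D" "w \<in> D"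
  shows "lempert \<Omega> (f z) (f w) = lempert D z w"
proof -
  have "(\<exists>\<phi>. holo_disc \<phi> \<Omega> \<and> \<phi> 0 = f z \<and> \<phi> t = f w) \<longleftrightarrow>
        (\<exists>\<phi>. holo_disc \<phi> D \<and> \<phi> 0 = z \<and> \<phi> t = w)" for t
  proof safe
    fix \<phi> assume "holo_disc \<phi> \<Omega>" "\<phi> 0 = f z" "\<phi> t = f w"
    then show "\<exists>\<phi>. holo_disc \<phi> D \<and> \<phi> 0 = z \<and> \<phi> t = w"
      using holo_disc_compose[OF g] gf zw by (intro exI[of _ "g \<circ> \<phi>"]) auto
  next
    fix \<phi> assume "holo_disc \<phi> D" "z = \<phi> 0" "w = \<phi> t"
    then show "\<exists>\<phi>'. holo_disc \<phi>' \<Omega> \<and> \<phi>' 0 = f (\<phi> 0) \<and> \<phi>' t = f (\<phi> t)"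
      using holo_disc_compose[OF f] by (intro exI[of _ "f \<circ> \<phi>"]) auto
  qed
  then have "{artanh (cmod t) | t \<phi>. t \<in> ball 0 1 \<and> holo_disc \<phi> \<Omega> \<and> \<phi> 0 = f z \<and> \<phi> t = f w} =
        {artanh (cmod t) | t \<phi>. t \<in> ball 0 1 \<and> holo_disc \<phi> D \<and> \<phi> 0 = z \<and> \<phi> t = w}"
    by blast
  then show ?thesis
    unfolding lempert_def by simp
qed

text \<open>Chains correspond under \<open>map f\<close> and \<open>map g\<close>, and every link
  keeps its Lempert value.\<close>

lemma kob_biholomorphic:
  fixes D \<Omega> :: "(complex ^ 'n) set"
  assumes f: "holo_on f D" "f ` D \<subseteq> \<Omega>" and g: "holo_on g \<Omega>" "g ` \<Omega> \<subseteq> D"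
    and gf: "\<And>z. z \<in> D \<Longrightarrow> g (f z) = z" and fg: "\<And>w. w \<in> \<Omega> \<Longrightarrow> f (g w) = w"
    and zw: "z \<in> D" "w \<in> D"
  shows "kob \<Omega> (f z) (f w) = kob D z w"
proof -
  define len where "len U xs = (\<Sum>i<length xs - 1. lempert U (xs ! i) (xs ! Suc i))"
    for U :: "(complex ^ 'n) set" and xs
  define chain where "chain U z w xs \<longleftrightarrow> xs \<noteq> [] \<and> hd xs = z \<and> last xs = w \<and> set xs \<subseteq> U"
    for U :: "(complex ^ 'n) set" and z w xs
  have len: "len \<Omega> (map f xs) = len D xs" if "set xs \<subseteq> D" for xs
    unfolding len_def length_map
  proof (rule sum.cong)
    fix i assume "i \<in> {..<length xs - 1}"
    then have i: "i < length xs" "Suc i < length xs" by auto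
    then have "xs ! i \<in> D" "xs ! Suc i \<in> D"
      using that by (meson nth_mem subsetD)+
    then show "lempert \<Omega> (map f xs ! i) (map f xs ! Suc i) = lempert D (xs ! i) (xs ! Suc i)"
      using i lempert_biholomorphic[OF f g gf] by simp
  qed simp
  have "chain \<Omega> (f z) (f w) ys \<longleftrightarrow> (\<exists>xs. chain D z w xs \<and> ys = map f xs)" for ys
  proof
    assume ys: "chain \<Omega> (f z) (f w) ys"
    have "map f (map g ys) = ys"
      using ys fg by (auto simp: chain_def subset_iff intro!: map_idI)
    moreover have "chain D z w (map g ys)"
      using ys g(2) gf zw by (auto simp: chain_def hd_map last_map)
    ultimately show "\<exists>xs. chain D z w xs \<and> ys = map f xs"
      by metis
  next
    assume "\<exists>xs. chain D z w xs \<and> ys = map f xs"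
    then show "chain \<Omega> (f z) (f w) ys"
      using f(2) by (fastforce simp: chain_def hd_map last_map)
  qed
  then have "{len \<Omega> ys | ys. chain \<Omega> (f z) (f w) ys} = {len \<Omega> (map f xs) | xs. chain D z w xs}"
    by auto
  also have "\<dots> = {len D xs | xs. chain D z w xs}"
    using len by (auto simp: chain_def) metis+
  finally show ?thesis
    unfolding kob_def len_def chain_def by simp
qed

section \<open>Extension of the biholomorphism\<close>

theorem theorem1p6:
  fixes D \<Omega> :: "(complex ^ 'n) set" and \<Psi> :: "complex ^ 'n \<Rightarrow> complex ^ 'n"
  assumes "domain D" and "bounded D" and "kob_complete D"
    and "domain \<Omega>" and "bounded \<Omega>" and "kob_complete \<Omega>"
    and "metrically_regular D"
    and "\<exists>p\<in>\<Omega>. (\<forall>x\<in>frontier \<Omega>. \<forall>R>0. horo_s \<Omega> p x R \<noteq> {}) \<and>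
                 (\<forall>x\<in>frontier \<Omega>. \<forall>y\<in>frontier \<Omega>. x \<noteq> y \<longrightarrow>
                     (\<exists>R>0. horo_b \<Omega> p x R \<noteq> horo_b \<Omega> p y R))"
    and "biholomorphism \<Psi> D \<Omega>"
  shows "\<exists>F G. homeomorphism (closure D) (closure \<Omega>) F G \<and> (\<forall>z\<in>D. F z = \<Psi> z)"
proof -
  have op: "open D" "open \<Omega>"
    using assms unfolding domain_def by auto
  have fr: "frontier D = closure D - D" "frontier \<Omega> = closure \<Omega> - \<Omega>"
    using op by (simp_all add: frontier_def interior_open)
  obtain g where f: "holo_on \<Psi> D" "\<Psi> ` D \<subseteq> \<Omega>" and g: "holo_on g \<Omega>" "g ` \<Omega> \<subseteq> D"
    and gf: "\<And>z. z \<in> D \<Longrightarrow> g (\<Psi> z) = z" and fg: "\<And>w. w \<in> \<Omega> \<Longrightarrow> \<Psi> (g w) = w"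
    using assms(9) unfolding biholomorphism_def bij_betw_def by blast
  have kobg: "kob D (g z) (g w) = kob \<Omega> z w" if "z \<in> \<Omega>" "w \<in> \<Omega>" for z w
    using kob_biholomorphic[OF f g gf fg, of "g z" "g w"] that g(2) by (simp add: fg image_subset_iff)
  obtain p where p: "p \<in> \<Omega>"
    and small: "\<And>x R. x \<in> frontier \<Omega> \<Longrightarrow> R > 0 \<Longrightarrow> horo_s \<Omega> p x R \<noteq> {}"
    and big: "\<And>x y. x \<in> frontier \<Omega> \<Longrightarrow> y \<in> frontier \<Omega> \<Longrightarrow> x \<noteq> y \<Longrightarrow>
                \<exists>R>0. horo_b \<Omega> p x R \<noteq> horo_b \<Omega> p y R"
    using assms(8) by blast
  obtain o' where o': "o' \<in> D"
    and ex: "\<And>\<xi> z. \<xi> \<in> frontier D \<Longrightarrow> z \<in> D \<Longrightarrow>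
          \<exists>L. ((\<lambda>w. kob D z w - kob D o' w) \<longlongrightarrow> L) (at \<xi> within D)"
    and disj: "\<And>\<xi> \<eta>. \<xi> \<in> frontier D \<Longrightarrow> \<eta> \<in> frontier D \<Longrightarrow> \<xi> \<noteq> \<eta> \<Longrightarrow>
          \<exists>R>0. horo D o' \<xi> R \<inter> horo D o' \<eta> R = {}"
    using assms(7) unfolding metrically_regular_def by blast
  \<comment> \<open>Written with \<open>Lim\<close> as in \<open>horo\<close>, so that
    \<open>horo D o' \<xi> R\<close> is by definition a sublevel set of
    \<open>h \<xi>\<close>.\<close>
  define h where "h \<xi> z = Lim (at \<xi> within D) (\<lambda>w. kob D z w - kob D o' w)" for \<xi> z
  \<comment> \<open>\<open>Lim\<close> is meaningful only for nontrivial filters; a boundary point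
    of an open set is a limit point of it.\<close>
  have within_nontrivial: "at x within S \<noteq> bot" if "x \<in> closure S - S" for x and S :: "(complex ^ 'n) set"
    using that by (auto simp: trivial_limit_within closure_def)
  have h: "((\<lambda>w. kob D z w - kob D o' w) \<longlongrightarrow> h \<xi> z) (at \<xi> within D)"
    if "\<xi> \<in> frontier D" "z \<in> D" for \<xi> z
    using ex[OF that] within_nontrivial[of \<xi> D] that(1) tendsto_Lim unfolding h_def fr by blast

  \<comment> \<open>Cluster points of \<open>g\<close> at the boundary\<close>
  have cluster: "\<xi> \<in> frontier D \<and>
      (\<forall>z\<in>\<Omega>. ((\<lambda>w. kob \<Omega> z w - kob \<Omega> p w) \<longlongrightarrow> h \<xi> (g z) - h \<xi> (g p)) F)"
    if x: "x \<in> frontier \<Omega>" and F: "F \<le> at x within \<Omega>" "F \<noteq> bot" and lim: "(g \<longlongrightarrow> \<xi>) F" for x \<xi> F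
  proof -
    have ev\<Omega>: "eventually (\<lambda>w. w \<in> \<Omega>) F"
      by (rule filter_leD[OF F(1)]) (simp add: eventually_at_filter)
    then have evD: "eventually (\<lambda>w. g w \<in> D) F"
      by eventually_elim (use g(2) in blast)
    have "\<xi> \<in> closure D"
      by (rule Lim_in_closed_set[OF closed_closure _ F(2) lim])
        (use evD in \<open>eventually_elim, use closure_subset in blast\<close>)
    \<comment> \<open>An interior cluster point would give \<open>w = \<Psi> (g w)\<close> the limit
      \<open>\<Psi> \<xi>\<close> in \<open>\<Omega>\<close>, but \<open>w\<close> tends to
      \<open>x\<close> outside \<open>\<Omega>\<close>.\<close>
    moreover have "\<xi> \<notin> D"
    proof
      assume \<xi>: "\<xi> \<in> D"
      have "isCont \<Psi> \<xi>"
        using holo_on_imp_continuous_on[OF f(1)] op(1) \<xi> continuous_on_eq_continuous_at by blast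
      then have "((\<lambda>w. \<Psi> (g w)) \<longlongrightarrow> \<Psi> \<xi>) F"
        using lim isCont_tendsto_compose by blast
      then have "((\<lambda>w. w) \<longlongrightarrow> \<Psi> \<xi>) F"
        by (rule Lim_transform_eventually) (use ev\<Omega> in \<open>eventually_elim, simp add: fg\<close>)
      moreover have "((\<lambda>w. w) \<longlongrightarrow> x) F"
        by (rule tendsto_mono[OF F(1)]) simp
      ultimately have "x = \<Psi> \<xi>"
        using tendsto_unique F(2) by blast
      then show False
        using x \<xi> f(2) fr by auto
    qed
    ultimately have \<xi>: "\<xi> \<in> frontier D" using fr by simp
    have "filterlim g (at \<xi> within D) F"
      unfolding filterlim_at using lim evD \<open>\<xi> \<notin> D\<close> by (auto elim: eventually_mono)
    then have lim': "((\<lambda>w. kob D z (g w) - kob D o' (g w)) \<longlongrightarrow> h \<xi> z) F" if "z \<in> D" for z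
      using filterlim_compose[OF h[OF \<xi> that]] by blast
    have "((\<lambda>w. kob \<Omega> z w - kob \<Omega> p w) \<longlongrightarrow> h \<xi> (g z) - h \<xi> (g p)) F" if z: "z \<in> \<Omega>" for z
    proof (rule Lim_transform_eventually)
      \<comment> \<open>Change of pole from \<open>o'\<close> to \<open>g p\<close>: the
        \<open>o'\<close> terms cancel, and invariance of \<open>kob\<close> does the rest.\<close>
      show "((\<lambda>w. (kob D (g z) (g w) - kob D o' (g w)) - (kob D (g p) (g w) - kob D o' (g w)))
              \<longlongrightarrow> h \<xi> (g z) - h \<xi> (g p)) F"
        using z p g(2) by (intro tendsto_diff[OF lim' lim']) auto
      show "eventually (\<lambda>w. (kob D (g z) (g w) - kob D o' (g w)) - (kob D (g p) (g w) - kob D o' (g w))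
              = kob \<Omega> z w - kob \<Omega> p w) F"
        using ev\<Omega> by eventually_elim (simp add: kobg z p)
    qed
    with \<xi> show ?thesis by blast
  qed

  \<comment> \<open>Uniqueness of the cluster point\<close>
  have unique: "\<xi> = \<eta>"
    if x: "x \<in> frontier \<Omega>"
      and F: "F \<le> at x within \<Omega>" "F \<noteq> bot" "(g \<longlongrightarrow> \<xi>) F"
      and F': "F' \<le> at x within \<Omega>" "F' \<noteq> bot" "(g \<longlongrightarrow> \<eta>) F'" for x \<xi> \<eta> F F'
  proof (rule ccontr)
    assume "\<xi> \<noteq> \<eta>"
    moreover have fr\<xi>: "\<xi> \<in> frontier D" "\<eta> \<in> frontier D"
      using cluster[OF x F] cluster[OF x F'] by auto
    ultimately obtain R where R: "R > 0" "horo D o' \<xi> R \<inter> horo D o' \<eta> R = {}"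
      using disj by blast
    \<comment> \<open>The maximum serves both cluster points at once; the \<open>- 1\<close>
      restores the strict inequality lost in the limit.\<close>
    define c where "c = ln R / 2 - max (h \<xi> (g p)) (h \<eta> (g p)) - 1"
    \<comment> \<open>The radius \<open>exp (2 * c)\<close> is the one whose half logarithm is
      \<open>c\<close>.\<close>
    obtain z where z: "z \<in> \<Omega>"
      and ls: "Limsup (at x within \<Omega>) (\<lambda>w. ereal (kob \<Omega> z w - kob \<Omega> p w)) < ereal c"
      using small[OF x, of "exp (2 * c)"] unfolding horo_s_def by auto
    have ev: "eventually (\<lambda>w. kob \<Omega> z w - kob \<Omega> p w \<le> c) (at x within \<Omega>)"
      using Limsup_lessD[OF ls] by eventually_elim simp
    \<comment> \<open>A bound on the \<open>Limsup\<close> passes to every finer filter, so the same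
      \<open>z\<close> works for \<open>\<xi>\<close> and \<open>\<eta>\<close>.\<close>
    have "h \<zeta> (g z) - h \<zeta> (g p) \<le> c"
      if "E \<le> at x within \<Omega>" "E \<noteq> bot" "(g \<longlongrightarrow> \<zeta>) E" for \<zeta> E
      using cluster[OF x that] z filter_leD[OF that(1) ev] that(2) tendsto_upperbound by blast
    from this[OF F] this[OF F'] have "h \<xi> (g z) < ln R / 2" "h \<eta> (g z) < ln R / 2"
      unfolding c_def by linarith+
    then have "g z \<in> horo D o' \<xi> R \<inter> horo D o' \<eta> R"
      using z g(2) unfolding horo_def h_def by auto
    with R show False by blast
  qed

  have "\<exists>\<xi>. (g \<longlongrightarrow> \<xi>) (at x within \<Omega>)" if x: "x \<in> frontier \<Omega>" for x
  proof -
    have K: "compact (closure D)" "eventually (\<lambda>w. g w \<in> closure D) (at x within \<Omega>)"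
      using assms(2) subset_trans[OF g(2) closure_subset]
      by (auto simp: eventually_at_filter image_subset_iff)
    have "at x within \<Omega> \<noteq> bot"
      using within_nontrivial x fr by blast
    from compact_cluster_filter[OF K(1) this K(2)]
    obtain \<xi> F where "F \<le> at x within \<Omega>" "F \<noteq> bot" "(g \<longlongrightarrow> \<xi>) F" .
    then have "(g \<longlongrightarrow> \<xi>) (at x within \<Omega>)"
      using unique[OF x] by (intro tendsto_if_unique_cluster_point[OF K]) blast
    then show ?thesis ..
  qed
  then obtain b where b: "\<And>x. x \<in> frontier \<Omega> \<Longrightarrow> (g \<longlongrightarrow> b x) (at x within \<Omega>)"
    by metis
  \<comment> \<open>Taking the full filter in \<open>cluster\<close> gives genuine limits at
    \<open>x\<close>.\<close>
  have limb: "b x \<in> frontier D"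
    "\<And>z. z \<in> \<Omega> \<Longrightarrow> ((\<lambda>w. kob \<Omega> z w - kob \<Omega> p w) \<longlongrightarrow> h (b x) (g z) - h (b x) (g p)) (at x within \<Omega>)"
    if "x \<in> frontier \<Omega>" for x
    using cluster[OF that order_refl _ b[OF that]] within_nontrivial that fr by auto

  \<comment> \<open>Injectivity on the boundary\<close>
  have inj_b: "x = y" if x: "x \<in> frontier \<Omega>" and y: "y \<in> frontier \<Omega>" and eq: "b x = b y" for x y
  proof (rule ccontr)
    assume "x \<noteq> y"
    have "Liminf (at u within \<Omega>) (\<lambda>w. ereal (kob \<Omega> z w - kob \<Omega> p w)) = ereal (h (b u) (g z) - h (b u) (g p))"
      if "u \<in> frontier \<Omega>" "z \<in> \<Omega>" for u z
      using limb(2)[OF that] within_nontrivial that fr by (intro lim_imp_Liminf) auto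
    then have "horo_b \<Omega> p x R = horo_b \<Omega> p y R" for R
      using x y eq unfolding horo_b_def by auto
    then show False
      using big[OF x y \<open>x \<noteq> y\<close>] by blast
  qed

  \<comment> \<open>Gluing \<open>g\<close> with its boundary values\<close>
  define G where "G x = (if x \<in> \<Omega> then g x else b x)" for x
  have "(G \<longlongrightarrow> G x) (at x within \<Omega>)" if x: "x \<in> closure \<Omega>" for x
  proof (rule Lim_transform_eventually)
    show "(g \<longlongrightarrow> G x) (at x within \<Omega>)"
      using holo_on_imp_continuous_on[OF g(1)] b[of x] x fr
      by (auto simp: G_def continuous_on_def)
    show "eventually (\<lambda>w. g w = G w) (at x within \<Omega>)"
      by (simp add: eventually_at_filter G_def)
  qed
  then have cont: "continuous_on (closure \<Omega>) G"
    by (rule continuous_on_closure_if_tendsto)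
  have cp: "compact (closure \<Omega>)"
    using assms(5) by simp
  have GD: "x \<in> \<Omega> \<Longrightarrow> G x \<in> D" and Gfr: "x \<in> frontier \<Omega> \<Longrightarrow> G x \<in> frontier D" for x
    using g(2) limb(1) fr by (auto simp: G_def)
  have "G ` closure \<Omega> = closure D"
  proof
    show "G ` closure \<Omega> \<subseteq> closure D"
      using GD Gfr fr closure_subset by blast
    have "D \<subseteq> G ` \<Omega>"
      using f(2) gf by (force simp: G_def image_iff)
    \<comment> \<open>The compact image is closed and contains \<open>D\<close>, hence also its
      closure.\<close>
    then have "D \<subseteq> G ` closure \<Omega>"
      using closure_subset by blast
    then show "closure D \<subseteq> G ` closure \<Omega>"
      using compact_imp_closed[OF compact_continuous_image[OF cont cp]] by (rule closure_minimal)
  qed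
  moreover have "inj_on G (closure \<Omega>)"
  proof (rule inj_onI)
    fix x y assume x: "x \<in> closure \<Omega>" and y: "y \<in> closure \<Omega>" and eq: "G x = G y"
    \<comment> \<open>Mixed cases are excluded: \<open>D\<close> is open, so it is disjoint from its
      frontier.\<close>
    then consider "x \<in> \<Omega>" "y \<in> \<Omega>" | "x \<in> frontier \<Omega>" "y \<in> frontier \<Omega>"
      using GD[of x] GD[of y] Gfr[of x] Gfr[of y] unfolding fr by auto
    then show "x = y"
    proof cases
      case 1
      then show ?thesis using arg_cong[OF eq, of \<Psi>] by (simp add: G_def fg)
    next
      case 2
      then show ?thesis using eq inj_b fr by (auto simp: G_def)
    qed
  qed
  \<comment> \<open>A continuous bijection from a compact space to a Hausdorff space is a
    homeomorphism; its inverse \<open>F\<close> is the required extension of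
    \<open>\<Psi>\<close>.\<close>
  ultimately obtain F where F: "homeomorphism (closure \<Omega>) (closure D) G F"
    using homeomorphism_compact[OF cp cont] by blast
  have "F z = \<Psi> z" if "z \<in> D" for z
  proof -
    have "\<Psi> z \<in> \<Omega>" using that f(2) by blast
    moreover from this have "G (\<Psi> z) = z" using that gf by (simp add: G_def)
    ultimately show ?thesis
      using homeomorphism_apply1[OF F, of "\<Psi> z"] closure_subset by auto
  qed
  then show ?thesis
    using homeomorphism_symD[OF F] by blast
qed

end
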